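(* Let $n$ be odd and squarefree with $\Omega(n)\neq 2,3$ and every prime divisor of $n$ at least $7$. Let $p'$ be a prime divisor of $n$ and $A=L(n;p')$. Then a sequence $S$ in $\mathbb{Z}_n$ is an $A$-extremal sequence for the Davenport constant if and only if $S$ is a $U(n)$-extremal sequence for the Davenport constant.
   Context: $\mathbb{Z}_n$ is the integers mod $n$, $U(n)$ its unit group. For nonempty $A\subseteq\mathbb{Z}_n\setminus\{0\}$, a sequence $(x_1,\ldots,x_k)$ is an $A$-weighted zero-sum sequence if $\sum a_ix_i=0$ for some $a_i\in A$; $D_A(n)$ is the least $k$ such that every length-$k$ sequence in $\mathbb{Z}_n$ has a nonempty $A$-weighted zero-sum subsequence; an $A$-extremal sequence for the Davenport constant is a sequence of length $D_A(n)-1$ with no $A$-weighted zero-sum subsequence. $\Omega(n)$ is the number of prime factors with multiplicity. For odd $n=\prod p_i^{r_i}$, prime $p\mid n$ and $a\in U(n)$, $\left(\frac{a}{p}\right)$ is the Legendre symbol of the image of $a$ mod $p$ and $\left(\frac{a}{n}\right)=\prod\left(\frac{a}{p_i}\right)^{r_i}$. $L(n;p')=\{a\in U(n):\left(\frac{a}{n}\right)=\left(\frac{a}{p'}\right)\}$. *)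

theory Defs
  imports "HOL-Number_Theory.Number_Theory" "HOL-Computational_Algebra.Squarefree"
begin

text \<open>Elements of Z_n are represented by naturals in {0..<n}; sequences are lists.\<close>

definition units_mod :: "nat \<Rightarrow> nat set" where
  "units_mod n = {a. a < n \<and> coprime a n}"

definition has_wzs :: "nat \<Rightarrow> nat set \<Rightarrow> nat list \<Rightarrow> bool" where
  "has_wzs n A S \<longleftrightarrow> (\<exists>I w. I \<subseteq> {..<length S} \<and> I \<noteq> {} \<and> (\<forall>i\<in>I. w i \<in> A)
      \<and> (\<Sum>i\<in>I. w i * S ! i) mod n = 0)"

definition seq_in :: "nat \<Rightarrow> nat list \<Rightarrow> bool" where
  "seq_in n S \<longleftrightarrow> set S \<subseteq> {..<n}"

definition davenport_w :: "nat \<Rightarrow> nat set \<Rightarrow> nat" where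
  "davenport_w n A = (LEAST k. \<forall>S. seq_in n S \<and> length S = k \<longrightarrow> has_wzs n A S)"

definition extremal_davenport :: "nat \<Rightarrow> nat set \<Rightarrow> nat list \<Rightarrow> bool" where
  "extremal_davenport n A S \<longleftrightarrow> seq_in n S \<and> length S = davenport_w n A - 1 \<and> \<not> has_wzs n A S"

definition jacobi_sym :: "nat \<Rightarrow> nat \<Rightarrow> int" where
  "jacobi_sym a n = (\<Prod>p\<in>prime_factors n. Legendre (int a) (int p) ^ multiplicity p n)"

definition Lset :: "nat \<Rightarrow> nat \<Rightarrow> nat set" where
  "Lset n p' = {a \<in> units_mod n. jacobi_sym a n = Legendre (int a) (int p')}"

end

theory Submission
  imports Defs
begin

text \<open>
  Let \<open>Q\<close> be the set of primes of \<open>n\<close> other than \<open>p'\<close>, so that \<open>Lset n p'\<close> consists of the units whose Legendre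
  symbols modulo the primes in \<open>Q\<close> multiply to 1. By the Chinese remainder theorem, weights for the
  terms with index in \<open>I\<close> may be chosen separately modulo each prime. Unit weights with zero sum exist
  iff no prime \<open>p\<close> has exactly one \<open>i \<in> I\<close> with \<open>x i\<close> nonzero modulo \<open>p\<close>. If at least three terms are
  nonzero modulo \<open>p \<ge> 7\<close>, then the Legendre symbols of the weights modulo \<open>p\<close> can be prescribed; for
  exactly two nonzero terms this holds at all indices but one. Hence unit weights on \<open>I\<close> can be replaced
  by weights in \<open>Lset n p'\<close>, unless for all primes in \<open>Q\<close> exactly the same two terms are nonzero. In that
  case, once the sequence has at least four terms, another index set works. So for
  sequences of length at least 4 the two weight sets are interchangeable. If \<open>n\<close> has at least four
  prime factors, extremal sequences are that long; if \<open>n\<close> is prime, the two weight sets coincide.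
\<close>

section \<open>Legendre symbols modulo an odd prime\<close>

lemma Legendre_values: "Legendre a p \<in> {-1, 0, 1}"
  by (auto simp: Legendre_def)

lemma Legendre_eq_0_iff: "Legendre a (int p) = 0 \<longleftrightarrow> int p dvd a"
  by (auto simp: Legendre_def cong_0_iff)

lemma Legendre_sign:
  assumes "\<not> int p dvd a"
  shows "Legendre a (int p) = 1 \<or> Legendre a (int p) = -1"
  using assms by (auto simp: Legendre_def cong_0_iff)

lemma Legendre_cong:
  assumes "[a = b] (mod p)"
  shows "Legendre a p = Legendre b p"
  using assms by (simp add: Legendre_def QuadRes_def cong_def)

text \<open>Euler's criterion gives the identity modulo \<open>p\<close>. Both sides lie in {-1, 0,
  1}, so they differ by at most 2, which is less than \<open>p\<close>.\<close>

lemma Legendre_mult: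
  assumes "prime p" "2 < p"
  shows "Legendre (a * b) (int p) = Legendre a (int p) * Legendre b (int p)"
proof -
  have "[Legendre (a * b) (int p) = (a * b) ^ ((p - 1) div 2)] (mod int p)"
    using euler_criterion[OF assms] .
  moreover have "[Legendre a (int p) * Legendre b (int p) = a ^ ((p - 1) div 2) * b ^ ((p - 1) div 2)] (mod int p)"
    using euler_criterion[OF assms] by (intro cong_mult) 
  ultimately have "[Legendre (a * b) (int p) = Legendre a (int p) * Legendre b (int p)] (mod int p)"
    by (metis cong_sym cong_trans power_mult_distrib)
  then have "int p dvd Legendre (a * b) (int p) - Legendre a (int p) * Legendre b (int p)"
    by (simp add: cong_iff_dvd_diff)
  moreover have "\<bar>Legendre (a * b) (int p) - Legendre a (int p) * Legendre b (int p)\<bar> < int p"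
    using Legendre_values[of "a * b" p] Legendre_values[of a p] Legendre_values[of b p] \<open>2 < p\<close> by auto
  ultimately have "Legendre (a * b) (int p) - Legendre a (int p) * Legendre b (int p) = 0"
    using dvd_imp_le_int[of "Legendre (a * b) (int p) - Legendre a (int p) * Legendre b (int p)" "int p"]
    by linarith
  then show ?thesis by simp
qed

lemma Legendre_square:
  assumes "prime p" "\<not> int p dvd a"
  shows "Legendre (a * a) (int p) = 1"
proof -
  have "\<not> int p dvd a * a"
    using assms by (simp add: prime_dvd_mult_iff)
  moreover have "QuadRes (int p) (a * a)"
    unfolding QuadRes_def by (metis cong_refl power2_eq_square)
  ultimately show ?thesis by (simp add: Legendre_def cong_0_iff)
qed

lemma Legendre_one: "prime p \<Longrightarrow> Legendre 1 (int p) = 1"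
  using Legendre_square[of p 1] by (simp add: prime_nat_iff)

lemma linear_cong_solvable:
  assumes "prime p" "\<not> int p dvd a"
  obtains x where "[x * a = b] (mod int p)"
proof -
  have "coprime a (int p)"
    using assms prime_imp_coprime[of "int p" a] by (simp add: coprime_commute)
  then obtain y where "[a * y = 1] (mod int p)" using cong_solve_coprime_int by blast
  then have "[b * (a * y) = b * 1] (mod int p)" by (intro cong_mult) auto
  then show thesis using that[of "b * y"] by (simp add: ac_simps)
qed

text \<open>Otherwise squaring would permute the nonzero residues, although it identifies 1 and -1.\<close>
lemma Legendre_least_nonresidue:
  assumes "prime p" "2 < p"
  obtains g :: int where "1 < g" "Legendre g (int p) = -1" "Legendre (g - 1) (int p) = 1"
proof -
  have "\<exists>k\<in>{1..<p}. Legendre (int k) (int p) = -1"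
  proof (rule ccontr)
    assume "\<not> ?thesis"
    then have res: "Legendre (int k) (int p) = 1" if "k \<in> {1..<p}" for k
      using that Legendre_sign[of p "int k"] by (force simp: int_dvd_int_iff dest: dvd_imp_le)
    let ?f = "\<lambda>x. x * x mod p"
    have "{1..<p} \<subseteq> ?f ` {1..<p}"
    proof
      fix k assume k: "k \<in> {1..<p}"
      from res[OF k] have "QuadRes (int p) (int k)" by (auto simp: Legendre_def split: if_splits)
      then obtain y where "[y ^ 2 = int k] (mod int p)" unfolding QuadRes_def by blast
      moreover have "[(y mod int p) ^ 2 = y ^ 2] (mod int p)" by (intro cong_pow) simp
      ultimately have "[(y mod int p) ^ 2 = int k] (mod int p)" using cong_trans by blast
      moreover define x where "x = nat (y mod int p)"
      ultimately have "[int (x ^ 2) = int k] (mod int p)" using k by simp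
      then have "[x ^ 2 = k] (mod p)" using cong_int_iff by blast
      then have fx: "?f x = k" using k by (simp add: cong_def power2_eq_square)
      moreover have "x < p" using k unfolding x_def by (simp add: nat_less_iff)
      moreover have "x \<noteq> 0" using fx k by (intro notI) simp
      ultimately show "k \<in> ?f ` {1..<p}" by (intro image_eqI[of _ _ x]) auto
    qed
    then have "inj_on ?f {1..<p}" by (intro finite_surj_inj[of "{1..<p}" ?f] | simp)+
    moreover have "?f 1 = ?f (p - 1)"
    proof -
      have "(p - 1) * (p - 1) = 1 + (p - 2) * p"
        using \<open>2 < p\<close> by (cases p; cases "p - 1") (auto simp: algebra_simps)
      then have "(p - 1) * (p - 1) mod p = 1 mod p" by (simp only: mod_mult_self1)
      then show ?thesis by simp
    qed
    ultimately have "1 = p - 1" using \<open>2 < p\<close> inj_onD[of ?f "{1..<p}" 1 "p - 1"] by simp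
    then show False using \<open>2 < p\<close> by simp
  qed
  then have ex: "\<exists>k. Legendre (int k) (int p) = -1" by blast
  define g where "g = (LEAST k. Legendre (int k) (int p) = -1)"
  have g: "Legendre (int g) (int p) = -1" unfolding g_def using ex by (rule LeastI_ex)
  have less: "Legendre (int k) (int p) \<noteq> -1" if "k < g" for k
    using that not_less_Least unfolding g_def by blast
  have "g \<noteq> 0" using g Legendre_eq_0_iff[of 0 p] by (intro notI) simp
  moreover have "g \<noteq> 1" using g Legendre_one[OF assms(1)] by (intro notI) simp
  ultimately have g1: "1 < g" by simp
  \<comment> \<open>Otherwise \<open>g - p\<close> would be a smaller nonresidue. Hence
    \<open>g - 1\<close> is nonzero modulo \<open>p\<close>, and minimality of \<open>g\<close>
    leaves 1 as its symbol.\<close>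
  have "g < p"
  proof (rule ccontr)
    assume "\<not> g < p"
    then have "Legendre (int (g - p)) (int p) = -1" 
      using g Legendre_cong[of "int (g - p)" "int g" "int p"] by (simp add: of_nat_diff cong_iff_dvd_diff)
    then show False using less[of "g - p"] \<open>\<not> g < p\<close> g1 assms by simp
  qed
  have "\<not> int p dvd int (g - 1)" using \<open>g < p\<close> g1 by (intro zdvd_not_zless) auto
  then have "Legendre (int (g - 1)) (int p) = 1" using less[of "g - 1"] g1 Legendre_sign by auto
  then show thesis using that[of "int g"] g g1 by (simp add: of_nat_diff)
qed

section \<open>Sums with prescribed Legendre symbols\<close>

text \<open>Up to a common factor, the identities 9 + 16 = 25, (g - 1) + 1 = g for the least nonresidue g,
  and, depending on the residue characters of -1, 2 and 3, one of g - (g - 1) = 1, 2 - 1 = 1,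
  4 - 3 = 1 and 3 - 2 = 1 realise all pairs of signs.\<close>
lemma sign_pattern_sum:
  assumes p: "prime p" "7 \<le> p" and ab: "\<alpha> \<in> {1, -1}" "\<beta> \<in> {1, -1::int}"
  obtains a b c where "a + b = c" "Legendre c (int p) \<noteq> 0"
    "Legendre a (int p) = \<alpha> * Legendre c (int p)" "Legendre b (int p) = \<beta> * Legendre c (int p)"
proof -
  let ?L = "\<lambda>a. Legendre a (int p)"
  have p2: "2 < p" using p by simp
  have mult: "?L (a * b) = ?L a * ?L b" for a b using Legendre_mult[OF p(1) p2] .
  have one: "?L 1 = 1" using Legendre_one[OF p(1)] .
  have sgn: "?L a = 1 \<or> ?L a = -1" if "0 < a" "a < int p" for a
    using that by (intro Legendre_sign zdvd_not_zless)
  have sq: "?L (a * a) = 1" if "0 < a" "a < int p" for a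
    using that p(1) by (intro Legendre_square zdvd_not_zless)
  have s9: "?L 9 = 1" and s16: "?L 16 = 1" and s25: "?L 25 = 1" and s4: "?L 4 = 1"
    using sq[of 3] sq[of 4] sq[of 5] sq[of 2] p by simp_all
  have neg: "?L (- a) = ?L (-1) * ?L a" for a using mult[of "-1" a] by simp
  have neg1: "?L (-1) = 1 \<or> ?L (-1) = -1" 
    using mult[of "-1" "-1"] one Legendre_values[of "-1" p] by auto
  obtain g where g: "1 < g" "?L g = -1" "?L (g - 1) = 1"
    using Legendre_least_nonresidue[OF p(1) p2] .
  have mixed: "\<exists>a b. a + b = 1 \<and> ?L a = 1 \<and> ?L b = -1"
  proof (cases "?L (-1) = 1")
    case True
    then show ?thesis using g neg[of "g - 1"] by (intro exI[of _ "- (g - 1)"] exI[of _ g]) simp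
  next
    case False
    then have n: "?L (-1) = -1" using neg1 by simp
    consider "?L 2 = 1" | "?L 2 = -1" "?L 3 = 1" | "?L 2 = -1" "?L 3 = -1"
      using sgn[of 2] sgn[of 3] p by force
    then show ?thesis
    proof cases
      case 1
      then show ?thesis using n by (intro exI[of _ 2] exI[of _ "-1"]) simp
    next
      case 2
      then show ?thesis using n s4 neg[of 3] by (intro exI[of _ 4] exI[of _ "-3"]) simp
    next
      case 3
      then show ?thesis using n neg[of 2] by (intro exI[of _ "-2"] exI[of _ 3]) simp
    qed
  qed
  then obtain x y where xy: "x + y = 1" "?L x = 1" "?L y = -1" by blast
  consider "\<alpha> = 1" "\<beta> = 1" | "\<alpha> = -1" "\<beta> = -1" | "\<alpha> = 1" "\<beta> = -1" | "\<alpha> = -1" "\<beta> = 1"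
    using ab by auto
  then show thesis
  proof cases
    case 1
    then show thesis using that[of 9 16 25] s9 s16 s25 by simp
  next
    case 2
    then show thesis using that[of "g - 1" 1 g] g one by simp
  next
    case 3
    then show thesis using that[of x y 1] xy one by simp
  next
    case 4
    then show thesis using that[of y x 1] xy one by simp
  qed
qed

text \<open>A pattern \<open>a + b = c\<close> is scaled by some \<open>s\<close> with
  \<open>s * c\<close> congruent to \<open>t\<close>. Multiplication by \<open>s\<close> changes
  symbols by the factor that takes the symbol of \<open>c\<close> to that of \<open>t\<close>, so
  the pattern is requested with both signs twisted by the symbol of \<open>t\<close>.\<close>

lemma two_term_sum:
  assumes p: "prime p" "7 \<le> p" and ab: "\<alpha> \<in> {1, -1}" "\<beta> \<in> {1, -1::int}" and t: "\<not> int p dvd t"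
  obtains u v where "[u + v = t] (mod int p)" "Legendre u (int p) = \<alpha>" "Legendre v (int p) = \<beta>"
proof -
  let ?L = "\<lambda>a. Legendre a (int p)"
  have mult: "?L (a * b) = ?L a * ?L b" for a b using Legendre_mult[OF p(1)] p(2) by simp
  have Lt: "?L t \<in> {1, -1}" using Legendre_sign[OF t] by simp
  then have "\<alpha> * ?L t \<in> {1, -1}" "\<beta> * ?L t \<in> {1, -1}" using ab by auto
  from sign_pattern_sum[OF p this] obtain a b c where abc: "a + b = c" "?L c \<noteq> 0"
    "?L a = \<alpha> * ?L t * ?L c" "?L b = \<beta> * ?L t * ?L c" .
  then obtain s where s: "[s * c = t] (mod int p)" 
    using linear_cong_solvable[OF p(1), of c t] Legendre_eq_0_iff by blast
  then have Ls: "?L s * ?L c = ?L t" using Legendre_cong mult by metis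
  show thesis
  proof (rule that)
    show "[s * a + s * b = t] (mod int p)" using s abc(1) by (simp flip: distrib_left)
    show "?L (s * a) = \<alpha>" "?L (s * b) = \<beta>"
      using Ls Lt abc by (auto simp: mult)
  qed
qed

text \<open>It suffices to find \<open>w\<close> of symbol \<gamma> with \<open>t - w\<close>
  nonzero modulo \<open>p\<close>; the other two summands then come from
  \<open>two_term_sum\<close>.\<close>

lemma three_term_sum:
  assumes p: "prime p" "7 \<le> p"
    and abc: "\<alpha> \<in> {1, -1}" "\<beta> \<in> {1, -1}" "\<gamma> \<in> {1, -1::int}"
  obtains u v w where "[u + v + w = t] (mod int p)"
    "Legendre u (int p) = \<alpha>" "Legendre v (int p) = \<beta>" "Legendre w (int p) = \<gamma>"
proof -
  let ?L = "\<lambda>a. Legendre a (int p)"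
  have p2: "2 < p" using p by simp
  have mult: "?L (a * b) = ?L a * ?L b" for a b using Legendre_mult[OF p(1) p2] .
  obtain g where "?L g = -1" using Legendre_least_nonresidue[OF p(1) p2] by blast
  then obtain w0 where w0: "?L w0 = \<gamma>" using abc(3) Legendre_one[OF p(1)] by auto
  have "\<not> int p dvd 2" "\<not> int p dvd 3" using p zdvd_not_zless[of 2 "int p"] zdvd_not_zless[of 3 "int p"] by auto
  then have "?L (2 * 2 * w0) = \<gamma>" 
    using Legendre_square[OF p(1), of 2] mult[of "2 * 2" w0] w0 by simp
  \<comment> \<open>Both \<open>w0\<close> and \<open>4 * w0\<close> have symbol \<gamma>. They
    differ by \<open>3 * w0\<close>, which is nonzero modulo \<open>p\<close>, so \<open>t\<close>
    is not congruent to both.\<close>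
  moreover have "\<not> int p dvd t - w0 \<or> \<not> int p dvd t - 2 * 2 * w0"
  proof (rule ccontr)
    assume "\<not> ?thesis"
    then have "int p dvd (t - w0) - (t - 2 * 2 * w0)" using dvd_diff by blast
    then have "int p dvd 3 * w0" by simp
    moreover have "prime (int p)" using p by simp
    ultimately have "int p dvd w0" using \<open>\<not> int p dvd 3\<close> prime_dvd_mult_iff by blast
    then show False using w0 abc(3) Legendre_eq_0_iff[of w0 p] by auto
  qed
  ultimately obtain w where w: "?L w = \<gamma>" "\<not> int p dvd t - w" using w0 by blast
  obtain u v where "[u + v = t - w] (mod int p)" "?L u = \<alpha>" "?L v = \<beta>"
    using two_term_sum[OF p abc(1,2) w(2)] .
  moreover from this(1) have "[u + v + w = t] (mod int p)"
    by (simp add: cong_iff_dvd_diff algebra_simps)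
  ultimately show thesis using that w(1) by blast
qed

section \<open>Zero sums with prescribed symbols modulo one prime\<close>

definition supp :: "(nat \<Rightarrow> nat) \<Rightarrow> nat set \<Rightarrow> nat \<Rightarrow> nat set" where
  "supp x I p = {i \<in> I. \<not> p dvd x i}"

text \<open>Translates a wanted value \<open>u\<close> of a weighted term into a weight: dividing by
  \<open>y\<close> multiplies the symbol by that of \<open>y\<close>, which is its own
  inverse.\<close>

lemma solve_coefficient:
  assumes p: "prime p" "2 < p" and y: "\<not> int p dvd y" and u: "Legendre u (int p) = \<epsilon> * Legendre y (int p)"
  obtains v where "[v * y = u] (mod int p)" "Legendre v (int p) = \<epsilon>"
proof -
  obtain v where v: "[v * y = u] (mod int p)" using linear_cong_solvable[OF p(1) y] .
  then have "Legendre v (int p) * Legendre y (int p) = Legendre u (int p)"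
    using Legendre_cong Legendre_mult[OF p] by metis
  then have "Legendre v (int p) = \<epsilon>" using u Legendre_sign[OF y] by auto
  then show thesis using that v by blast
qed

lemma Legendre_choice:
  assumes p: "prime p" "2 < p" and \<epsilon>: "\<forall>i. \<epsilon> i \<in> {1, -1::int}"
  shows "\<exists>d. \<forall>i. Legendre (d i) (int p) = \<epsilon> i"
proof -
  obtain g where "Legendre g (int p) = -1" using Legendre_least_nonresidue[OF p] by blast
  then have "\<exists>v. Legendre v (int p) = \<epsilon> i" for i using \<epsilon>[rule_format, of i] Legendre_one[OF p(1)] by auto
  then show ?thesis by metis
qed

text \<open>All weights outside three indices of the support are fixed first, with the right
  symbols. By \<open>three_term_sum\<close>, the three remaining terms can then sum to minus the
  rest, whatever it is.\<close>

lemma signed_zero_sum_many: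
  assumes p: "prime p" "7 \<le> p" and I: "finite I" and card: "3 \<le> card (supp x I p)"
    and \<epsilon>: "\<forall>i. \<epsilon> i \<in> {1, -1::int}"
  shows "\<exists>v. int p dvd (\<Sum>i\<in>I. v i * int (x i)) \<and> (\<forall>i. Legendre (v i) (int p) = \<epsilon> i)"
proof -
  let ?L = "\<lambda>a. Legendre a (int p)"
  have p2: "2 < p" using p by simp
  obtain d where d: "\<And>i. ?L (d i) = \<epsilon> i" using Legendre_choice[OF p(1) p2 \<epsilon>] by metis
  obtain T where "T \<subseteq> supp x I p" "card T = 3" using card obtain_subset_with_card_n by metis
  then obtain a b c where abc: "{a, b, c} \<subseteq> supp x I p" "a \<noteq> b" "b \<noteq> c" "a \<noteq> c"
    by (auto simp: card_3_iff)
  let ?J = "I - {a, b, c}"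
  have nd: "\<not> int p dvd int (x i)" if "i \<in> {a, b, c}" for i using abc that by (auto simp: supp_def)
  have sg: "\<epsilon> i * ?L (int (x i)) \<in> {1, -1}" if "i \<in> {a, b, c}" for i
    using \<epsilon>[rule_format, of i] Legendre_sign[OF nd[OF that]] by auto
  obtain u v w where uvw: "[u + v + w = - (\<Sum>i\<in>?J. d i * int (x i))] (mod int p)"
    "?L u = \<epsilon> a * ?L (int (x a))" "?L v = \<epsilon> b * ?L (int (x b))" "?L w = \<epsilon> c * ?L (int (x c))"
    using three_term_sum[OF p sg[of a] sg[of b] sg[of c]] by blast
  obtain u' where u': "[u' * int (x a) = u] (mod int p)" "?L u' = \<epsilon> a"
    using solve_coefficient[OF p(1) p2 nd[of a] uvw(2)] by auto
  obtain v' where v': "[v' * int (x b) = v] (mod int p)" "?L v' = \<epsilon> b"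
    using solve_coefficient[OF p(1) p2 nd[of b] uvw(3)] by auto
  obtain w' where w': "[w' * int (x c) = w] (mod int p)" "?L w' = \<epsilon> c"
    using solve_coefficient[OF p(1) p2 nd[of c] uvw(4)] by auto
  define f where "f = d(a := u', b := v', c := w')"
  have "I = insert a (insert b (insert c ?J))" using abc by (auto simp: supp_def)
  moreover have "(\<Sum>i\<in>insert a (insert b (insert c ?J)). f i * int (x i)) =
      u' * int (x a) + v' * int (x b) + w' * int (x c) + (\<Sum>i\<in>?J. f i * int (x i))"
    using I abc by (simp add: f_def)
  moreover have "(\<Sum>i\<in>?J. f i * int (x i)) = (\<Sum>i\<in>?J. d i * int (x i))"
    by (intro sum.cong) (auto simp: f_def)
  ultimately have "(\<Sum>i\<in>I. f i * int (x i)) =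
      u' * int (x a) + v' * int (x b) + w' * int (x c) + (\<Sum>i\<in>?J. d i * int (x i))" by simp
  moreover have "[u' * int (x a) + v' * int (x b) + w' * int (x c) + (\<Sum>i\<in>?J. d i * int (x i))
      = u + v + w + (\<Sum>i\<in>?J. d i * int (x i))] (mod int p)"
    using u' v' w' by (intro cong_add) auto
  moreover have "[u + v + w + (\<Sum>i\<in>?J. d i * int (x i)) = 0] (mod int p)"
    using uvw(1) by (simp add: cong_iff_dvd_diff)
  ultimately have "[(\<Sum>i\<in>I. f i * int (x i)) = 0] (mod int p)" using cong_trans by metis
  moreover have "?L (f i) = \<epsilon> i" for i using d u' v' w' by (simp add: f_def)
  ultimately show ?thesis by (auto simp: cong_0_iff)
qed

text \<open>Once the other index \<open>k\<close> of the support has its weight, the equation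
  determines the weight at \<open>j\<close> modulo \<open>p\<close>. Its symbol is therefore not at
  choice, but it is nonzero because the term at \<open>k\<close> is.\<close>

lemma signed_zero_sum_two:
  assumes p: "prime p" "2 < p" and I: "finite I" and card: "card (supp x I p) = 2"
    and j: "j \<in> supp x I p" and \<epsilon>: "\<forall>i. \<epsilon> i \<in> {1, -1::int}"
  shows "\<exists>v. int p dvd (\<Sum>i\<in>I. v i * int (x i)) \<and> (\<forall>i. i \<noteq> j \<longrightarrow> Legendre (v i) (int p) = \<epsilon> i)
    \<and> Legendre (v j) (int p) \<noteq> 0"
proof -
  let ?L = "\<lambda>a. Legendre a (int p)"
  obtain d where d: "\<And>i. ?L (d i) = \<epsilon> i" using Legendre_choice[OF p \<epsilon>] by metis
  obtain k where k: "supp x I p = {j, k}" "k \<noteq> j"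
    using card j unfolding card_2_iff by (metis insertE insert_commute singletonD)
  have mem: "j \<in> I" "k \<in> I" and nd: "\<not> int p dvd int (x j)" "\<not> int p dvd int (x k)"
    using k by (auto simp: supp_def set_eq_iff)
  obtain u where u: "[u * int (x j) = - (d k * int (x k))] (mod int p)"
    using linear_cong_solvable[OF p(1) nd(1)] .
  have "?L (- (d k * int (x k))) \<noteq> 0"
    using p nd(2) d[of k] \<epsilon>[rule_format, of k] Legendre_eq_0_iff[of "d k" p]
    by (auto simp: Legendre_eq_0_iff prime_dvd_mult_iff)
  then have Lu: "?L u \<noteq> 0"
    using Legendre_cong[OF u] Legendre_mult[OF p] by auto
  define f where "f = d(j := u)"
  have "(\<Sum>i\<in>I. f i * int (x i)) = u * int (x j) + (d k * int (x k) + (\<Sum>i\<in>I - {j} - {k}. f i * int (x i)))"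
    using I mem k(2) by (simp add: sum.remove[of I j] sum.remove[of "I - {j}" k] f_def)
  moreover have "int p dvd (\<Sum>i\<in>I - {j} - {k}. f i * int (x i))"
    using k by (intro dvd_sum dvd_mult) (auto simp: supp_def set_eq_iff)
  moreover have "int p dvd u * int (x j) + d k * int (x k)" using u by (simp add: cong_iff_dvd_diff)
  ultimately have "int p dvd (\<Sum>i\<in>I. f i * int (x i))" by (simp add: dvd_add flip: add.assoc)
  moreover have "?L (f i) = \<epsilon> i" if "i \<noteq> j" for i using d that by (simp add: f_def)
  moreover have "?L (f j) \<noteq> 0" using Lu by (simp add: f_def)
  ultimately show ?thesis by blast
qed

lemma signed_zero_sum_none:
  assumes p: "prime p" "2 < p" and I: "finite I" and card: "card (supp x I p) = 0"
    and \<epsilon>: "\<forall>i. \<epsilon> i \<in> {1, -1::int}"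
  shows "\<exists>v. int p dvd (\<Sum>i\<in>I. v i * int (x i)) \<and> (\<forall>i. Legendre (v i) (int p) = \<epsilon> i)"
proof -
  let ?L = "\<lambda>a. Legendre a (int p)"
  obtain d where d: "\<And>i. ?L (d i) = \<epsilon> i" using Legendre_choice[OF p \<epsilon>] by metis
  have "supp x I p = {}" using card I by (simp add: supp_def)
  then have "int p dvd (\<Sum>i\<in>I. d i * int (x i))"
    by (intro dvd_sum dvd_mult) (auto simp: supp_def)
  then show ?thesis using d by blast
qed

lemma signed_zero_sum:
  assumes p: "prime p" "7 \<le> p" and I: "finite I" and card: "card (supp x I p) \<notin> {1, 2}"
    and \<epsilon>: "\<forall>i. \<epsilon> i \<in> {1, -1::int}"
  shows "\<exists>v. int p dvd (\<Sum>i\<in>I. v i * int (x i)) \<and> (\<forall>i. Legendre (v i) (int p) = \<epsilon> i)"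
proof -
  consider "card (supp x I p) = 0" | "3 \<le> card (supp x I p)" using card by force
  then show ?thesis
    using signed_zero_sum_none[OF p(1) _ I _ \<epsilon>] signed_zero_sum_many[OF p I _ \<epsilon>] p(2)
    by cases auto
qed

lemma unit_zero_sum:
  assumes p: "prime p" "7 \<le> p" and I: "finite I" and card: "card (supp x I p) \<noteq> 1"
  shows "\<exists>v. int p dvd (\<Sum>i\<in>I. v i * int (x i)) \<and> (\<forall>i. Legendre (v i) (int p) \<noteq> 0)"
proof (cases "card (supp x I p) = 2")
  case True
  then obtain j where j: "j \<in> supp x I p" by (auto simp: card_2_iff)
  obtain v where "int p dvd (\<Sum>i\<in>I. v i * int (x i))" "\<forall>i. i \<noteq> j \<longrightarrow> Legendre (v i) (int p) = 1"
    "Legendre (v j) (int p) \<noteq> 0"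
    using signed_zero_sum_two[OF p(1) _ I True j, of "\<lambda>_. 1"] p(2) by auto
  then show ?thesis by (metis one_neq_zero)
next
  case False
  then obtain v where "int p dvd (\<Sum>i\<in>I. v i * int (x i))" "\<forall>i. Legendre (v i) (int p) = 1"
    using signed_zero_sum[OF p I, of x "\<lambda>_. 1"] card by auto
  then show ?thesis by (metis one_neq_zero)
qed

section \<open>Balancing symbols across several primes\<close>

lemma prod_sign:
  assumes "\<And>p. p \<in> A \<Longrightarrow> f p = 1 \<or> f p = (-1::int)"
  shows "prod f A \<in> {1, -1}"
  using assms
proof (induction A rule: infinite_finite_induct)
  case (insert x A)
  then have "f x = 1 \<or> f x = -1" "prod f A \<in> {1, -1}" by auto
  then show ?case using insert.hyps by auto
qed simp_all

text \<open>If the supports of \<open>q\<close> and \<open>r\<close> are distinct pairs, then at some index the weight is free modulo \<open>r\<close>,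
  which makes up for the one Legendre symbol that cannot be prescribed modulo \<open>q\<close>.\<close>
definition spread :: "(nat \<Rightarrow> nat) \<Rightarrow> nat set \<Rightarrow> nat set \<Rightarrow> bool" where
  "spread x I Q \<longleftrightarrow> (\<exists>q\<in>Q. card (supp x I q) \<noteq> 2 \<or> (\<exists>r\<in>Q. supp x I q \<noteq> supp x I r))"

text \<open>Starting from arbitrary unit weights at each prime, the weights at one \<open>q\<close>
  in \<open>Q\<close> are replaced so that every product becomes 1. If the support at
  \<open>q\<close> is not a pair, this succeeds at once. Otherwise it fails at most at one index
  \<open>j\<close>, which is repaired modulo a second prime \<open>r\<close>.\<close>

lemma sign_balanced_family:
  assumes P: "\<And>p. p \<in> P \<Longrightarrow> prime p \<and> 7 \<le> p" and Q: "Q \<subseteq> P" "finite Q" and I: "finite I"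
    and card: "\<And>p. p \<in> P \<Longrightarrow> card (supp x I p) \<noteq> 1" and spread: "spread x I Q"
  shows "\<exists>v. (\<forall>p\<in>P. int p dvd (\<Sum>i\<in>I. v p i * int (x i)) \<and> (\<forall>i. Legendre (v p i) (int p) \<noteq> 0))
    \<and> (\<forall>i. (\<Prod>p\<in>Q. Legendre (v p i) (int p)) = 1)"
proof -
  have "\<forall>p\<in>P. \<exists>v. int p dvd (\<Sum>i\<in>I. v i * int (x i)) \<and> (\<forall>i. Legendre (v i) (int p) \<noteq> 0)"
    using unit_zero_sum[of _ I x] P card I by blast
  then obtain v where v: "\<And>p. p \<in> P \<Longrightarrow> int p dvd (\<Sum>i\<in>I. v p i * int (x i))"
    "\<And>p i. p \<in> P \<Longrightarrow> Legendre (v p i) (int p) \<noteq> 0" by metis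
  have sgn: "Legendre a (int p) = 1 \<or> Legendre a (int p) = -1" if "Legendre a (int p) \<noteq> 0" for a p
    using that Legendre_sign Legendre_eq_0_iff by blast
  \<comment> \<open>Since signs are their own inverses, this is the symbol that the weight modulo
    \<open>q\<close> must have to make the product over \<open>Q\<close> equal to 1.\<close>
  define \<epsilon> where "\<epsilon> q i = (\<Prod>p\<in>Q - {q}. Legendre (v p i) (int p))" for q i
  have \<epsilon>: "\<forall>i. \<epsilon> q i \<in> {1, -1}" for q
    unfolding \<epsilon>_def using v(2) Q sgn by (intro allI prod_sign) blast
  have \<epsilon>2: "\<epsilon> q i * \<epsilon> q i = 1" for q i using \<epsilon>[of q] by (auto dest: spec[of _ i])
  have upd: "(\<Prod>p\<in>Q. Legendre ((v(q := f)) p i) (int p)) = Legendre (f i) (int q) * \<epsilon> q i"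
    if "q \<in> Q" for q f i
    using that Q(2) by (simp add: prod.remove[of Q q] \<epsilon>_def)
  show ?thesis
  proof (cases "\<exists>q\<in>Q. card (supp x I q) \<noteq> 2")
    case True
    then obtain q where q: "q \<in> Q" "card (supp x I q) \<notin> {1, 2}" using card Q by blast
    then obtain f where f: "int q dvd (\<Sum>i\<in>I. f i * int (x i))" "\<And>i. Legendre (f i) (int q) = \<epsilon> q i"
      using signed_zero_sum[of q I x "\<epsilon> q"] P Q I \<epsilon> by blast
    have "Legendre (f i) (int q) \<noteq> 0" for i using f(2) \<epsilon>2[of q i] by auto
    moreover have "(\<Prod>p\<in>Q. Legendre ((v(q := f)) p i) (int p)) = 1" for i
      unfolding upd[OF q(1)] f(2) by (rule \<epsilon>2)
    ultimately show ?thesis using v f(1) by (intro exI[of _ "v(q := f)"]) auto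
  next
    case False
    then obtain q r where qr: "q \<in> Q" "r \<in> Q" "supp x I q \<noteq> supp x I r"
      "card (supp x I q) = 2" "card (supp x I r) = 2"
      using spread unfolding spread_def by blast
    have "finite (supp x I r)" using I by (simp add: supp_def)
    then have "\<not> supp x I q \<subseteq> supp x I r" using qr card_subset_eq by metis
    then obtain j where j: "j \<in> supp x I q" "j \<notin> supp x I r" by blast
    have primes: "prime q" "2 < q" "prime r" "2 < r" using P[of q] P[of r] qr Q by auto
    obtain f where f: "int q dvd (\<Sum>i\<in>I. f i * int (x i))"
      "\<And>i. i \<noteq> j \<Longrightarrow> Legendre (f i) (int q) = \<epsilon> q i" "Legendre (f j) (int q) \<noteq> 0"
      using signed_zero_sum_two[OF primes(1,2) I qr(4) j(1) \<epsilon>] by blast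
    have fnz: "Legendre (f i) (int q) \<noteq> 0" for i using f(2)[of i] f(3) \<epsilon>2[of q i] by (cases "i = j") auto
    define u where "u = v(q := f)"
    have u: "int p dvd (\<Sum>i\<in>I. u p i * int (x i))" "Legendre (u p i) (int p) \<noteq> 0" if "p \<in> P" for p i
      using v that f(1) fnz by (auto simp: u_def)
    \<comment> \<open>The error left at \<open>j\<close>. Multiplying the symbol modulo
      \<open>r\<close> by \<open>e\<close> turns the product into \<open>e * e = 1\<close>.\<close>
    define e where "e = (\<Prod>p\<in>Q. Legendre (u p j) (int p))"
    have "\<And>p. p \<in> Q \<Longrightarrow> Legendre (u p j) (int p) = 1 \<or> Legendre (u p j) (int p) = -1"
      using u(2) sgn Q by blast
    then have e: "e \<in> {1, -1}" unfolding e_def by (rule prod_sign)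
    have "\<forall>i::nat. e * Legendre (u r j) (int r) \<in> {1, -1}" using e u(2)[of r j] sgn[of "u r j" r] qr Q by auto
    then obtain y where y: "Legendre y (int r) = e * Legendre (u r j) (int r)"
      using Legendre_choice[OF primes(3,4), of "\<lambda>_. e * Legendre (u r j) (int r)"] by blast
    define w where "w = u(r := (u r)(j := y))"
    \<comment> \<open>The new weight differs from the old one only at \<open>j\<close>, and
      \<open>r\<close> divides \<open>x j\<close>.\<close>
    have "int r dvd (\<Sum>i\<in>I. (w r i - u r i) * int (x i))"
      using j qr(1) by (intro dvd_sum) (auto simp: w_def supp_def)
    then have "int r dvd (\<Sum>i\<in>I. (w r i - u r i) * int (x i)) + (\<Sum>i\<in>I. u r i * int (x i))"
      using u(1)[of r] qr Q by (intro dvd_add) auto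
    also have "\<dots> = (\<Sum>i\<in>I. w r i * int (x i))"
      by (simp add: algebra_simps flip: sum.distrib)
    finally have "int r dvd (\<Sum>i\<in>I. w r i * int (x i))" .
    then have w1: "int p dvd (\<Sum>i\<in>I. w p i * int (x i))" if "p \<in> P" for p
      using u(1) that by (cases "p = r") (auto simp: w_def)
    have "Legendre y (int r) \<noteq> 0" using y e u(2)[of r j] qr Q by auto
    then have w2: "Legendre (w p i) (int p) \<noteq> 0" if "p \<in> P" for p i
      using u(2) that by (auto simp: w_def)
    have "(\<Prod>p\<in>Q. Legendre (w p i) (int p)) = 1" for i
    proof (cases "i = j")
      case True
      have "(\<Prod>p\<in>Q. Legendre (w p j) (int p)) = Legendre y (int r) * (\<Prod>p\<in>Q - {r}. Legendre (u p j) (int p))"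
        using qr Q(2) by (simp add: prod.remove[of Q r] w_def)
      also have "\<dots> = e * e"
        using qr Q(2) by (simp add: y e_def prod.remove[of Q r])
      finally show ?thesis using e True by auto
    next
      case False
      then have "(\<Prod>p\<in>Q. Legendre (w p i) (int p)) = (\<Prod>p\<in>Q. Legendre (u p i) (int p))"
        by (intro prod.cong) (auto simp: w_def)
      also have "\<dots> = Legendre (f i) (int q) * \<epsilon> q i" unfolding u_def by (rule upd[OF qr(1)])
      finally show ?thesis using f(2)[OF False] \<epsilon>2 by simp
    qed
    then show ?thesis using w1 w2 by blast
  qed
qed

section \<open>From residues modulo the primes to weights modulo \<open>n\<close>\<close>

lemma multiplicity_squarefree:
  assumes "squarefree (n::nat)" "p \<in> prime_factors n"
  shows "multiplicity p n = 1"
proof -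
  have "n \<noteq> 0" using assms(1) by (intro notI) simp
  then have "multiplicity p n \<le> 1"
    using assms squarefree_factorial_semiring''[of n] by auto
  moreover have "multiplicity p n > 0" using assms(2) by (simp add: prime_factors_multiplicity)
  ultimately show ?thesis by simp
qed

lemma prod_prime_factors_squarefree:
  assumes "squarefree (n::nat)"
  shows "\<Prod>(prime_factors n) = n"
proof -
  have "n \<noteq> 0" using assms by (intro notI) simp
  then have "n = (\<Prod>p\<in>prime_factors n. p ^ multiplicity p n)"
    by (simp add: prod_prime_factors)
  also have "\<dots> = \<Prod>(prime_factors n)"
    using multiplicity_squarefree[OF assms] by (intro prod.cong) auto
  finally show ?thesis ..
qed

text \<open>For squarefree \<open>n\<close> the Jacobi symbol is the plain product over the primes.
  Its factor at \<open>p'\<close> is the right-hand side of the defining equation, so it is enough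
  that the other factors multiply to 1.\<close>

lemma Lset_memI:
  assumes "squarefree n" "prime p'" "p' dvd n" "a < n"
    and nz: "\<And>p. p \<in> prime_factors n \<Longrightarrow> Legendre (int a) (int p) \<noteq> 0"
    and prod: "(\<Prod>p\<in>prime_factors n - {p'}. Legendre (int a) (int p)) = 1"
  shows "a \<in> Lset n p'"
proof -
  have "n \<noteq> 0" using \<open>a < n\<close> by simp
  have "coprime a n"
  proof (rule ccontr)
    assume "\<not> coprime a n"
    then obtain p where "prime p" "p dvd gcd a n"
      using prime_factor_nat[of "gcd a n"] unfolding coprime_iff_gcd_eq_1 by blast
    then have "prime p" "p dvd a" "p dvd n" by auto
    then show False using nz[of p] \<open>n \<noteq> 0\<close> by (simp add: in_prime_factors_iff Legendre_eq_0_iff)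
  qed
  moreover have "p' \<in> prime_factors n" using assms \<open>n \<noteq> 0\<close> by (simp add: in_prime_factors_iff)
  moreover have "jacobi_sym a n = (\<Prod>p\<in>prime_factors n. Legendre (int a) (int p))"
    unfolding jacobi_sym_def
    using multiplicity_squarefree[OF assms(1)] by (intro prod.cong) auto
  ultimately show ?thesis using prod \<open>a < n\<close>
    by (simp add: Lset_def units_mod_def prod.remove[of _ p'])
qed

text \<open>The balanced weights are glued by the Chinese remainder theorem. Membership and the zero
  sum can both be checked modulo each prime, because \<open>n\<close> is the product of its
  primes.\<close>

lemma Lset_zero_sum:
  assumes n: "squarefree n" "\<forall>p\<in>prime_factors n. 7 \<le> p" and p': "prime p'" "p' dvd n"
    and I: "finite I" and card: "\<forall>p\<in>prime_factors n. card (supp x I p) \<noteq> 1"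
    and spread: "spread x I (prime_factors n - {p'})"
  shows "\<exists>w. (\<forall>i\<in>I. w i \<in> Lset n p') \<and> (\<Sum>i\<in>I. w i * x i) mod n = 0"
proof -
  let ?P = "prime_factors n"
  have prime: "prime p" if "p \<in> ?P" for p using that by auto
  obtain v where v: "\<And>p. p \<in> ?P \<Longrightarrow> int p dvd (\<Sum>i\<in>I. v p i * int (x i))"
      "\<And>p i. p \<in> ?P \<Longrightarrow> Legendre (v p i) (int p) \<noteq> 0"
      "\<And>i. (\<Prod>p\<in>?P - {p'}. Legendre (v p i) (int p)) = 1"
    using sign_balanced_family[of ?P "?P - {p'}" I x, OF _ _ _ I _ spread] n(2) prime card by blast
  have "\<exists>a. a < n \<and> (\<forall>p\<in>?P. [int a = v p i] (mod int p))" for i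
  proof -
    \<comment> \<open>The integer weights may be negative; they are reduced to natural residues
      before gluing.\<close>
    have "\<exists>!a. a < (\<Prod>p\<in>?P. p) \<and> (\<forall>p\<in>?P. [a = nat (v p i mod int p)] (mod p))"
      using prime by (intro chinese_remainder_unique_nat) (auto intro: primes_coprime simp: prime_gt_0_nat)
    then obtain a where a: "a < n" "\<And>p. p \<in> ?P \<Longrightarrow> [a = nat (v p i mod int p)] (mod p)"
      using prod_prime_factors_squarefree[OF n(1)] by auto
    have "[int a = v p i] (mod int p)" if "p \<in> ?P" for p
    proof -
      have "[int a = int (nat (v p i mod int p))] (mod int p)" using a(2)[OF that] by (simp only: cong_int_iff)
      then show ?thesis using prime_gt_0_nat[OF prime[OF that]] by (simp add: cong_def)
    qed
    then show ?thesis using a(1) by blast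
  qed
  then obtain w where w: "\<And>i. w i < n" "\<And>i p. p \<in> ?P \<Longrightarrow> [int (w i) = v p i] (mod int p)" by metis
  have L: "Legendre (int (w i)) (int p) = Legendre (v p i) (int p)" if "p \<in> ?P" for p i
    using Legendre_cong[OF w(2)[OF that]] .
  have "w i \<in> Lset n p'" for i
  proof (rule Lset_memI[OF n(1) p' w(1)])
    show "Legendre (int (w i)) (int p) \<noteq> 0" if "p \<in> ?P" for p using L v(2) that by simp
    show "(\<Prod>p\<in>?P - {p'}. Legendre (int (w i)) (int p)) = 1"
      using v(3)[of i] L by simp
  qed
  moreover have "n dvd (\<Sum>i\<in>I. w i * x i)"
  proof -
    have "p dvd (\<Sum>i\<in>I. w i * x i)" if "p \<in> ?P" for p
    proof -
      have "[(\<Sum>i\<in>I. int (w i) * int (x i)) = (\<Sum>i\<in>I. v p i * int (x i))] (mod int p)"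
        using w(2)[OF that] by (intro cong_sum cong_mult) auto
      then have "int p dvd (\<Sum>i\<in>I. int (w i) * int (x i))" using v(1)[OF that] cong_dvd_iff by metis
      then have "int p dvd int (\<Sum>i\<in>I. w i * x i)" by simp
      then show ?thesis by (simp only: int_dvd_int_iff)
    qed
    then have "[(\<Sum>i\<in>I. w i * x i) = 0] (mod (\<Prod>p\<in>?P. p))"
      using prime by (intro coprime_cong_prod_nat) (auto intro: primes_coprime simp: cong_0_iff)
    then show ?thesis using prod_prime_factors_squarefree[OF n(1)] by (simp add: cong_0_iff)
  qed
  ultimately show ?thesis by (intro exI[of _ w]) simp
qed

section \<open>Supports of zero sums and the choice of index set\<close>

text \<open>A lone term that is nonzero modulo \<open>p\<close> stays nonzero after multiplication
  by a unit, so nothing can cancel it.\<close>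

lemma card_supp_zero_sum:
  assumes "finite I" "\<forall>i\<in>I. w i \<in> units_mod n" "(\<Sum>i\<in>I. w i * x i) mod n = 0" "prime p" "p dvd n"
  shows "card (supp x I p) \<noteq> 1"
proof
  assume "card (supp x I p) = 1"
  then obtain j where j: "supp x I p = {j}" by (auto simp: card_1_singleton_iff)
  then have jI: "j \<in> I" "\<not> p dvd x j" by (auto simp: supp_def)
  have "p dvd (\<Sum>i\<in>I. w i * x i)" using assms by (meson dvd_trans mod_0_imp_dvd)
  moreover have "(\<Sum>i\<in>I. w i * x i) = w j * x j + (\<Sum>i\<in>I - {j}. w i * x i)"
    using assms(1) jI by (simp add: sum.remove)
  moreover have "p dvd (\<Sum>i\<in>I - {j}. w i * x i)"
    using j by (intro dvd_sum dvd_mult) (auto simp: supp_def)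
  ultimately have "p dvd w j * x j" using dvd_add_left_iff by metis
  then have "p dvd w j" using jI assms(4) by (simp add: prime_dvd_mult_iff)
  moreover have "coprime (w j) n" using assms(2) jI by (simp add: units_mod_def)
  ultimately show False using assms(4,5) coprime_common_divisor not_prime_unit by blast
qed

text \<open>If \<open>I\<close> is not spread, all primes in \<open>Q\<close> have the same pair
  \<open>{a, b}\<close> as support in \<open>I\<close>. The new set is a zero term, or two terms
  seen only by \<open>p'\<close>, or it keeps \<open>a\<close> and \<open>b\<close> and contains a
  third term that some prime of \<open>Q\<close> sees.\<close>

lemma spread_index_set:
  assumes m: "4 \<le> m" and Q: "Q \<noteq> {}" "P = insert p' Q" 
    and I: "I \<subseteq> {..<m}" "I \<noteq> {}" "\<forall>p\<in>P. card (supp x I p) \<noteq> 1"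
  shows "\<exists>J\<subseteq>{..<m}. J \<noteq> {} \<and> (\<forall>p\<in>P. card (supp x J p) \<noteq> 1) \<and> spread x J Q"
proof (cases "spread x I Q")
  case True
  then show ?thesis using I by blast
next
  case not_spread: False
  obtain q0 where q0: "q0 \<in> Q" using Q by blast
  then have "card (supp x I q0) = 2" using not_spread unfolding spread_def by blast
  then obtain a b where ab: "supp x I q0 = {a, b}" "a \<noteq> b" by (auto simp: card_2_iff)
  then have abI: "a \<in> I" "b \<in> I" by (auto simp: supp_def)
  have abQ: "\<not> q dvd x a \<and> \<not> q dvd x b" if "q \<in> Q" for q
  proof -
    have "supp x I q = {a, b}" using not_spread that q0 ab(1) unfolding spread_def by blast
    then show ?thesis by (auto simp: supp_def)
  qed
  have big: "\<exists>c\<in>{..<m}. c \<notin> A" if "card A \<le> 3" "finite A" for A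
  proof (rule ccontr)
    assume "\<not> ?thesis"
    then have "card {..<m} \<le> card A" using that by (intro card_mono) auto
    then show False using that m by simp
  qed
  have card_3: "card {u, v, w} \<le> 3 \<and> finite {u, v, w}" for u v w :: nat
    using card_insert_le_m1[of 3 "{v, w}" u] card_insert_le_m1[of 2 "{w}" v] by simp
  \<comment> \<open>Keeping \<open>a\<close> and \<open>b\<close> gives every prime in
    \<open>Q\<close> a support of size at least 2, and \<open>c\<close> raises it to at least 3 for
    \<open>q\<close>, which makes \<open>J\<close> spread.\<close>
  have full: ?thesis
    if J: "J \<subseteq> {..<m}" "a \<in> J" "b \<in> J" "card (supp x J p') \<noteq> 1"
      and c: "c \<in> J" "c \<noteq> a" "c \<noteq> b" "q \<in> Q" "\<not> q dvd x c" for J c q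
  proof -
    have fin: "finite (supp x J p)" for p using J(1) finite_subset by (fastforce simp: supp_def)
    have "card {a, b} \<le> card (supp x J p)" if "p \<in> Q" for p
      using that abQ J fin by (intro card_mono) (auto simp: supp_def)
    then have "\<forall>p\<in>P. card (supp x J p) \<noteq> 1" using J(4) Q(2) ab(2) by fastforce
    moreover have "card {a, b, c} \<le> card (supp x J q)"
      using abQ J c fin by (intro card_mono) (auto simp: supp_def)
    then have "card (supp x J q) \<noteq> 2" using c ab(2) by auto
    then have "spread x J Q" using c(4) unfolding spread_def by blast
    ultimately show ?thesis using J by blast
  qed
  \<comment> \<open>In the last case no term vanishes modulo all of \<open>P\<close>, and at most
    one vanishes modulo all of \<open>Q\<close>: two such terms would both be nonzero modulo
    \<open>p'\<close> and form the second case.\<close>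
  consider (zero) z where "z < m" "\<forall>p\<in>P. p dvd x z"
    | (pair) c d where "c < m" "d < m" "c \<noteq> d" "\<forall>q\<in>Q. q dvd x c \<and> q dvd x d"
        "\<not> p' dvd x c" "\<not> p' dvd x d"
    | (few) "\<And>z. z < m \<Longrightarrow> \<exists>p\<in>P. \<not> p dvd x z"
        "\<And>c d. c < m \<Longrightarrow> d < m \<Longrightarrow> c \<noteq> d \<Longrightarrow> \<exists>q\<in>Q. \<not> q dvd x c \<or> \<not> q dvd x d"
    using Q(2) by (metis insertE insertI1)
  then show ?thesis
  proof cases
    case zero
    then have "supp x {z} p = {}" if "p \<in> P" for p using that by (auto simp: supp_def)
    then show ?thesis using zero Q by (intro exI[of _ "{z}"]) (auto simp: spread_def)
  next
    case pair
    then have "supp x {c, d} q = {}" if "q \<in> Q" for q using that by (auto simp: supp_def)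
    moreover have "supp x {c, d} p' = {c, d}" using pair by (auto simp: supp_def)
    ultimately show ?thesis using pair Q by (intro exI[of _ "{c, d}"]) (auto simp: spread_def)
  next
    case few
    show ?thesis
    proof (cases "card (supp x {..<m} p') = 1")
      \<comment> \<open>All indices are taken. Of two indices outside \<open>{a, b}\<close>,
        available since \<open>m\<close> is at least 4, at least one is seen by a prime of
        \<open>Q\<close>.\<close>
      case False
      obtain c where c: "c < m" "c \<notin> {a, b}" using big[of "{a, b}"] ab(2) by auto
      obtain d where d: "d < m" "d \<notin> {a, b, c}" using big[of "{a, b, c}"] card_3[of a b c] by blast
      then show ?thesis using few(2)[of c d] full[of "{..<m}"] abI I(1) False c by blast
    next
      \<comment> \<open>The only term \<open>e\<close> that \<open>p'\<close> sees must be dropped.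
        It is not in \<open>I\<close>, so \<open>a\<close> and \<open>b\<close> survive. A fourth
        index \<open>c\<close> vanishes modulo \<open>p'\<close> and is therefore seen by a prime of
        \<open>Q\<close>.\<close>
      case True
      then obtain e where e: "supp x {..<m} p' = {e}" by (auto simp: card_1_singleton_iff)
      have "supp x I p' \<noteq> {e}" using I(3) Q(2) by auto
      moreover have "supp x I p' = supp x {..<m} p' \<inter> I" using I(1) by (auto simp: supp_def)
      ultimately have "e \<notin> I" using e by auto
      obtain c where c: "c < m" "c \<notin> {a, b, e}" using big[of "{a, b, e}"] card_3[of a b e] by blast
      have "p' dvd x c" using c e by (auto simp: supp_def)
      then obtain q where "q \<in> Q" "\<not> q dvd x c" using few(1)[OF c(1)] Q(2) by blast
      moreover have "supp x ({..<m} - {e}) p' = {}" using e by (auto simp: supp_def)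
      ultimately show ?thesis using full[of "{..<m} - {e}" c q] c abI I(1) \<open>e \<notin> I\<close> by auto
    qed
  qed
qed

section \<open>Comparison of the two weight sets and their Davenport constants\<close>

lemma has_wzs_mono:
  assumes "A \<subseteq> B" "has_wzs n A S"
  shows "has_wzs n B S"
proof -
  obtain I w where "I \<subseteq> {..<length S}" "I \<noteq> {}" "\<forall>i\<in>I. w i \<in> A" "(\<Sum>i\<in>I. w i * S ! i) mod n = 0"
    using assms(2) unfolding has_wzs_def by (elim exE conjE) (rule that)
  moreover from this(3) assms(1) have "\<forall>i\<in>I. w i \<in> B" by blast
  ultimately show ?thesis unfolding has_wzs_def by (intro exI[of _ I] exI[of _ w] conjI)
qed

text \<open>A zero sum with unit weights yields an index set without singleton supports. It is
  exchanged for a spread one, on which weights in \<open>Lset n p'\<close> exist; the index set may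
  change along with the weights.\<close>

lemma has_wzs_Lset_iff:
  assumes n: "squarefree n" "\<forall>p\<in>prime_factors n. 7 \<le> p" and p': "prime p'" "p' dvd n"
    and Q: "prime_factors n \<noteq> {p'}" and S: "4 \<le> length S"
  shows "has_wzs n (Lset n p') S \<longleftrightarrow> has_wzs n (units_mod n) S"
proof
  have "Lset n p' \<subseteq> units_mod n" by (auto simp: Lset_def)
  moreover assume "has_wzs n (Lset n p') S"
  ultimately show "has_wzs n (units_mod n) S" by (rule has_wzs_mono)
next
  assume "has_wzs n (units_mod n) S"
  then obtain I w where I: "I \<subseteq> {..<length S}" "I \<noteq> {}" "\<forall>i\<in>I. w i \<in> units_mod n"
    "(\<Sum>i\<in>I. w i * S ! i) mod n = 0" unfolding has_wzs_def by (elim exE conjE) (rule that)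
  have "n \<noteq> 0" using n(1) by (intro notI) simp
  then have mem: "p' \<in> prime_factors n" using p' by (simp add: in_prime_factors_iff)
  have "finite I" using I(1) finite_subset by blast
  then have "\<forall>p\<in>prime_factors n. card (supp ((!) S) I p) \<noteq> 1"
    using card_supp_zero_sum[OF _ I(3,4)] by auto
  with mem Q have "\<exists>J\<subseteq>{..<length S}. J \<noteq> {} \<and> (\<forall>p\<in>prime_factors n. card (supp ((!) S) J p) \<noteq> 1)
      \<and> spread ((!) S) J (prime_factors n - {p'})"
    by (intro spread_index_set[OF S _ _ I(1,2), where p' = p']) auto
  then obtain J where J: "J \<subseteq> {..<length S}" "J \<noteq> {}"
    "\<forall>p\<in>prime_factors n. card (supp ((!) S) J p) \<noteq> 1" "spread ((!) S) J (prime_factors n - {p'})"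
    by (elim exE conjE) (rule that)
  have "finite J" using J(1) finite_subset by blast
  from Lset_zero_sum[OF n p' this J(3,4)] obtain w' where
    "\<forall>i\<in>J. w' i \<in> Lset n p'" "(\<Sum>i\<in>J. w' i * S ! i) mod n = 0" by (elim exE conjE) (rule that)
  with J(1,2) show "has_wzs n (Lset n p') S"
    unfolding has_wzs_def by (intro exI[of _ J] exI[of _ w'] conjI)
qed

text \<open>Each term \<open>n div q\<close> is the only one that is nonzero modulo \<open>q\<close>.\<close>
lemma ex_seq_without_unit_zero_sum:
  assumes n: "squarefree n" and k: "k \<le> card (prime_factors n)"
  shows "\<exists>S. seq_in n S \<and> length S = k \<and> \<not> has_wzs n (units_mod n) S"
proof -
  have "n \<noteq> 0" using n by (intro notI) simp
  obtain T where T: "T \<subseteq> prime_factors n" "card T = k"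
    using k obtain_subset_with_card_n by metis
  then have "finite T" using finite_subset by blast
  define qs where "qs = sorted_list_of_set T"
  have qs: "set qs = T" "distinct qs" "length qs = k" using \<open>finite T\<close> T by (auto simp: qs_def)
  have pq: "prime q" "q dvd n" if "q \<in> T" for q using that T by auto
  define S where "S = map (\<lambda>q. n div q) qs"
  have "seq_in n S"
    using pq prime_gt_1_nat \<open>n \<noteq> 0\<close> qs by (force simp: seq_in_def S_def intro: div_less_dividend)
  moreover have "\<not> has_wzs n (units_mod n) S"
  proof
    assume "has_wzs n (units_mod n) S"
    then obtain I w where I: "I \<subseteq> {..<length S}" "I \<noteq> {}" "\<forall>i\<in>I. w i \<in> units_mod n"
      "(\<Sum>i\<in>I. w i * S ! i) mod n = 0" unfolding has_wzs_def by (elim exE conjE) (rule that)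
    obtain j where j: "j \<in> I" using I by blast
    then have jk: "j < k" using I qs by (auto simp: S_def)
    let ?q = "qs ! j"
    have qT: "?q \<in> T" using jk qs by (metis nth_mem)
    have "supp ((!) S) I ?q = {j}"
    proof
      show "supp ((!) S) I ?q \<subseteq> {j}"
      proof
        fix i assume i: "i \<in> supp ((!) S) I ?q"
        then have ik: "i < k" using I qs by (auto simp: supp_def S_def)
        then have "qs ! i \<in> T" using qs by (metis nth_mem)
        show "i \<in> {j}"
        proof (rule ccontr)
          assume "i \<notin> {j}"
          then have "?q \<noteq> qs ! i" using qs ik jk by (auto simp: nth_eq_iff_index_eq)
          then have "\<not> ?q dvd qs ! i" using pq[OF qT] pq[OF \<open>qs ! i \<in> T\<close>] primes_dvd_imp_eq by blast
          moreover have "?q dvd n div (qs ! i) * (qs ! i)" using pq[OF qT] pq[OF \<open>qs ! i \<in> T\<close>] by simp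
          ultimately have "?q dvd n div (qs ! i)"
            using pq[OF qT] prime_dvd_mult_iff by blast
          then show False using i ik qs by (simp add: supp_def S_def)
        qed
      qed
      have "\<not> ?q dvd n div ?q"
      proof
        assume "?q dvd n div ?q"
        then have "?q * ?q dvd n" using pq[OF qT] by (metis dvd_div_iff_mult dvd_0_left_iff \<open>n \<noteq> 0\<close>)
        then have "?q dvd 1" using n squarefreeD by (metis power2_eq_square)
        then show False using pq[OF qT] by auto
      qed
      then show "{j} \<subseteq> supp ((!) S) I ?q" using j jk qs by (simp add: supp_def S_def)
    qed
    moreover have "finite I" using I(1) finite_subset by blast
    ultimately show False using card_supp_zero_sum[OF _ I(3,4) pq[OF qT]] by simp
  qed
  ultimately show ?thesis using qs by (auto simp: S_def)
qed

text \<open>Two of the \<open>n + 1\<close> prefix sums coincide modulo \<open>n\<close>.\<close>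
lemma has_wzs_units_length:
  assumes "1 < n" "length S = n"
  shows "has_wzs n (units_mod n) S"
proof -
  let ?f = "\<lambda>k. (\<Sum>i<k. S ! i) mod n"
  have "?f ` {..n} \<subseteq> {..<n}" using assms(1) by (intro image_subsetI) simp
  then have "card (?f ` {..n}) < card {..n}" using card_mono[of "{..<n}" "?f ` {..n}"] by simp
  then have "\<not> inj_on ?f {..n}" by (rule pigeonhole)
  then obtain a b where ab: "a < b" "b \<le> n" "?f a = ?f b"
    unfolding inj_on_def by (metis atMost_iff linorder_neqE_nat)
  have "{..<b} = {..<a} \<union> {a..<b}" "{..<a} \<inter> {a..<b} = {}" using ab by auto
  then have "(\<Sum>i<b. S ! i) = (\<Sum>i<a. S ! i) + (\<Sum>i\<in>{a..<b}. S ! i)"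
    by (simp add: sum.union_disjoint)
  then have "[(\<Sum>i<a. S ! i) + (\<Sum>i\<in>{a..<b}. S ! i) = (\<Sum>i<a. S ! i) + 0] (mod n)"
    using ab(3) by (simp add: cong_def)
  then have "n dvd (\<Sum>i\<in>{a..<b}. 1 * S ! i)" unfolding cong_add_lcancel_nat by (simp add: cong_0_iff)
  then have "(\<Sum>i\<in>{a..<b}. 1 * S ! i) mod n = 0" by simp
  moreover have "1 \<in> units_mod n" using assms by (simp add: units_mod_def)
  ultimately show ?thesis
    unfolding has_wzs_def using ab assms(2) by (intro exI[of _ "{a..<b}"] exI[of _ "\<lambda>_. 1"]) auto
qed

theorem theorem5p1:
  fixes n p' :: nat and S :: "nat list"
  assumes "odd n" and "squarefree n"
    and "size (prime_factorization n) \<noteq> 2" and "size (prime_factorization n) \<noteq> 3"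
    and "\<forall>p\<in>prime_factors n. p \<ge> 7"
    and "prime p'" and "p' dvd n"
  shows "extremal_davenport n (Lset n p') S \<longleftrightarrow> extremal_davenport n (units_mod n) S"
proof -
  have "n \<noteq> 0" using \<open>odd n\<close> by (intro notI) simp
  have p'n: "p' \<in> prime_factors n" using assms(6,7) \<open>n \<noteq> 0\<close> by (simp add: in_prime_factors_iff)
  have n1: "1 < n" using \<open>n \<noteq> 0\<close> assms(6,7) by (cases "n = 1") auto
  note mult = multiplicity_squarefree[OF assms(2)]
  have "size (prime_factorization n) = (\<Sum>p\<in>prime_factors n. multiplicity p n)"
    unfolding size_multiset_overloaded_eq
    by (intro sum.cong) (auto simp: count_prime_factorization)
  also have "\<dots> = card (prime_factors n)" using mult by simp
  finally have size: "card (prime_factors n) \<noteq> 2" "card (prime_factors n) \<noteq> 3" using assms(3,4) by auto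
  show ?thesis
  proof (cases "prime_factors n = {p'}")
    case True
    \<comment> \<open>With a single prime the defining condition of \<open>Lset n p'\<close> holds
      for every unit.\<close>
    then have "jacobi_sym a n = Legendre (int a) (int p')" for a
      using mult by (simp add: jacobi_sym_def)
    then have "Lset n p' = units_mod n" by (simp add: Lset_def)
    then show ?thesis by simp
  next
    case False
    have "card (prime_factors n) \<noteq> 0" using p'n by auto
    moreover have "card (prime_factors n) \<noteq> 1" using False p'n by (auto simp: card_1_singleton_iff)
    ultimately have k: "4 \<le> card (prime_factors n)" using size by linarith
    note wzs_iff = has_wzs_Lset_iff[OF assms(2,5,6,7) False]
    let ?P = "\<lambda>A k. \<forall>S. seq_in n S \<and> length S = k \<longrightarrow> has_wzs n A S"
    have short: "\<not> ?P (units_mod n) m" if "m \<le> 4" for m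
      using ex_seq_without_unit_zero_sum[OF assms(2), of m] k that by auto
    have "has_wzs n (Lset n p') S \<Longrightarrow> has_wzs n (units_mod n) S" for S
      using has_wzs_mono[of "Lset n p'" "units_mod n" n S] by (auto simp: Lset_def)
    then have "?P (Lset n p') m = ?P (units_mod n) m" for m
      using short[of m] wzs_iff by (cases "m \<le> 4") auto
    then have D: "davenport_w n (Lset n p') = davenport_w n (units_mod n)"
      by (simp add: davenport_w_def)
    \<comment> \<open>Some length must work before the least one is known to have the property; then
      it exceeds 4, so extremal sequences have length at least 4.\<close>
    have "?P (units_mod n) n" using has_wzs_units_length[OF n1] by blast
    then have "?P (units_mod n) (davenport_w n (units_mod n))"
      unfolding davenport_w_def by (rule LeastI)
    then have "5 \<le> davenport_w n (units_mod n)"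
      using short[of "davenport_w n (units_mod n)"] not_less_eq_eq by fastforce
    then have "4 \<le> davenport_w n (units_mod n) - 1" by linarith
    then have "has_wzs n (Lset n p') S \<longleftrightarrow> has_wzs n (units_mod n) S"
      if "length S = davenport_w n (units_mod n) - 1"
      using wzs_iff[of S] that by presburger
    then show ?thesis unfolding extremal_davenport_def D by blast
  qed
qed

end
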